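(* Let $f,h:\mathbb{R}^d\to\mathbb{R}$ be differentiable with $\nabla f$ Lipschitz continuous with constant $L_f$ and $\nabla h$ Lipschitz continuous with constant $L_h$, with $f$ being $\rho_f$-weakly convex, $\rho_f\ge0$. Let $g:\mathbb{R}^d\to\mathbb{R}\cup\{+\infty\}$ be proper, lower semicontinuous and prox-bounded with threshold $\gamma_g>0$. Suppose that $\varphi:=f+g+h$ has a nonempty set of minimisers and is level-bounded. Let $\alpha\in(0,1)$ and $\lambda>0$ with $\lambda\alpha<2$, and let $\gamma\in(0,\min\{\gamma_g,(L_f+L_h)^{-1}\})$ satisfy in addition $$\gamma<\min\{\hat\gamma^+,\hat\gamma,\hat\gamma(L^+)\},$$ where the constants $\hat\gamma^+,\hat\gamma,\hat\gamma(L^+)$, depending on $L_f,L_h,\rho_f,\lambda,\alpha$, are defined in the context. Then ${\rm DY}_{\gamma,\alpha}$ is asymptotically regular, the damped shadow Davis-Yin sequence $(x^k)$ is bounded, and any of its cluster points is a stationary point of $\varphi$. Furthermore, $\lim_{k\to\infty}\varphi^{\rm DY}_\gamma(x^k)$ is a stationary value of $\varphi$.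
   Context: A function $\phi$ is $\rho$-weakly convex if $\phi+\frac{\rho}{2}\|\cdot\|^2$ is convex. It is level-bounded if all sets $\{x:\phi(x)\le a\}$, $a\in\mathbb{R}$, are bounded. A function $g$ is prox-bounded with threshold $\gamma_g>0$ if $g+\frac{1}{2\gamma_g}\|\cdot\|^2$ is bounded from below. The proximal operator is $\mathrm{prox}_{\gamma\phi}(x):=\mathrm{argmin}_{y}\{\phi(y)+\frac1{2\gamma}\|y-x\|^2\}$, possibly set-valued. Convention: $0^{-1}=+\infty$. Put $Y_\gamma(x)\in\mathrm{prox}_{\gamma g}(x-\gamma\nabla(f+h)(x))$ (a selection), $T_\gamma(x):=\mathrm{prox}_{\gamma f}\big((1-\lambda)x+\gamma\nabla f(x)+\lambda Y_\gamma(x)\big)$, and ${\rm DY}_{\gamma,\alpha}(x):=(1-\alpha)x+\alpha T_\gamma(x)$. The damped shadow Davis-Yin sequence is $x^{k+1}={\rm DY}_{\gamma,\alpha}(x^k)$, $k\ge0$, started from some $x^0\in\mathbb{R}^d$. An operator $S$ is asymptotically regular if, for any $u^0$, the sequence $u^{k+1}=S(u^k)$ satisfies $u^k-S(u^k)\to0$. For $\gamma>0$ the Davis-Yin envelope is $$\varphi_\gamma^{\rm DY}(x):=\inf_{y\in\mathbb{R}^d}\Big\{f(x)+\langle\nabla f(x),y-x\rangle+h(x)+\langle\nabla h(x),y-x\rangle+g(y)+\frac{1}{2\gamma}\|y-x\|^2\Big\}.$$ Stepsize constants. (a) If $L_f>\rho_f$: $\hat\gamma$ is a chosen number with $\hat\gamma\ge\frac{\lambda}{2(L_f-\rho_f)}$,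 and $\hat\gamma^+$ is the strictly positive root of the concave quadratic $$t\mapsto-\Big(\frac{L_f^2}{\lambda\alpha}+\frac{L_fL_h}{\lambda\alpha}\Big)t^2-\Big(\frac{2L_f}{\lambda\alpha}+\Big(\frac12+\frac{|1-\lambda\alpha|}{\lambda\alpha}\Big)L_h+\frac{\rho_fL_f}{2(L_f-\rho_f)}-\frac{L_f^2}{2(L_f-\rho_f)}\Big)t+\frac1{\lambda\alpha}-\frac12.$$ If $L_f\le\rho_f$, the terms $\hat\gamma$ and $\hat\gamma^+$ are omitted from the minimum. (b) $\hat\gamma(L):=\frac{\lambda}{2(L-\rho_f)}$ for $L>\rho_f$, and $L^+:=\max\{L_f,\eta^++\rho_f\}$, where $\eta^+$ is the strictly positive root of the convex quadratic $$p(\eta)=4\Big(\frac1{\lambda\alpha}-\frac12\Big)\eta^2-2\Big(\frac{2L_f}{\alpha}+\Big(\frac{\lambda}{2}+\frac{|1-\lambda\alpha|}{\alpha}\Big)L_h\Big)\eta-\lambda\Big(\rho_fL+L_f^2\,\frac{1-\alpha}{\alpha}+\frac{L_fL_h}{\alpha}\Big),\qquad L=\eta+\rho_f.$$ A point $x$ is a stationary point of $\varphi$ if $0\in\partial\varphi(x)$, with $\partial$ the limiting subdifferential; equivalently $0\in\partial g(x)+\nabla(f+h)(x)$. A number $\varphi^\star$ is a stationary value of $\varphi$ if $\varphi^\star=\varphi(x^\star)$ for some stationary point $x^\star$. *)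

theory Defs
  imports "HOL-Analysis.Analysis"
begin

text \<open>Functions with values in \<open>\<real> \<union> {+\<infinity>}\<close> are modelled as \<open>ereal\<close>-valued functions; the value
  \<open>-\<infinity>\<close> is excluded by \<open>proper\<close>.\<close>

definition proper :: "('a \<Rightarrow> ereal) \<Rightarrow> bool" where
  "proper \<phi> \<longleftrightarrow> (\<forall>x. \<phi> x \<noteq> -\<infinity>) \<and> (\<exists>x. \<phi> x \<noteq> \<infinity>)"

definition lower_semicontinuous :: "('a::topological_space \<Rightarrow> ereal) \<Rightarrow> bool" where
  "lower_semicontinuous \<phi> \<longleftrightarrow> (\<forall>x. \<phi> x \<le> Liminf (at x) \<phi>)"

definition weakly_convex :: "real \<Rightarrow> ('a::real_inner \<Rightarrow> real) \<Rightarrow> bool" where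
  "weakly_convex \<rho> \<phi> \<longleftrightarrow> convex_on UNIV (\<lambda>x. \<phi> x + \<rho> / 2 * (norm x)\<^sup>2)"

definition level_bounded :: "('a::metric_space \<Rightarrow> ereal) \<Rightarrow> bool" where
  "level_bounded \<phi> \<longleftrightarrow> (\<forall>a::real. bounded {x. \<phi> x \<le> ereal a})"

definition prox_bounded :: "real \<Rightarrow> ('a::real_inner \<Rightarrow> ereal) \<Rightarrow> bool" where
  "prox_bounded \<gamma>\<^sub>g \<phi> \<longleftrightarrow>
     \<gamma>\<^sub>g > 0 \<and> (\<exists>b::real. \<forall>x. ereal b \<le> \<phi> x + ereal (1 / (2 * \<gamma>\<^sub>g) * (norm x)\<^sup>2))"

text \<open>Meaningful only where the function is differentiable.\<close>

definition grad :: "('a::real_inner \<Rightarrow> real) \<Rightarrow> 'a \<Rightarrow> 'a" where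
  "grad \<phi> x = (THE D. GDERIV \<phi> x :> D)"

definition minimisers :: "('a \<Rightarrow> ereal) \<Rightarrow> 'a set" where
  "minimisers \<phi> = {x. \<forall>y. \<phi> x \<le> \<phi> y}"

definition prox :: "real \<Rightarrow> ('a::real_inner \<Rightarrow> ereal) \<Rightarrow> 'a \<Rightarrow> 'a set" where
  "prox \<gamma> \<phi> x = minimisers (\<lambda>y. \<phi> y + ereal (1 / (2 * \<gamma>) * (norm (y - x))\<^sup>2))"

text \<open>The operators below take the selection \<open>Y\<close> as an argument. Applying \<open>the_elem\<close> to the proximal
  set of \<open>f\<close> is justified when \<open>\<gamma> * L\<^sub>f < 1\<close>: the proximal objective is then strongly convex, so
  that this set is a singleton.\<close>

definition DY_T :: "real \<Rightarrow> real \<Rightarrow> ('a::real_inner \<Rightarrow> real) \<Rightarrow> ('a \<Rightarrow> 'a) \<Rightarrow> 'a \<Rightarrow> 'a" where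
  "DY_T \<gamma> lam f Y x =
     the_elem (prox \<gamma> (\<lambda>z. ereal (f z)) ((1 - lam) *\<^sub>R x + \<gamma> *\<^sub>R grad f x + lam *\<^sub>R Y x))"

definition DY :: "real \<Rightarrow> real \<Rightarrow> real \<Rightarrow> ('a::real_inner \<Rightarrow> real) \<Rightarrow> ('a \<Rightarrow> 'a) \<Rightarrow> 'a \<Rightarrow> 'a" where
  "DY \<gamma> \<alpha> lam f Y x = (1 - \<alpha>) *\<^sub>R x + \<alpha> *\<^sub>R DY_T \<gamma> lam f Y x"

definition DY_envelope ::
  "real \<Rightarrow> ('a::real_inner \<Rightarrow> real) \<Rightarrow> ('a \<Rightarrow> real) \<Rightarrow> ('a \<Rightarrow> ereal) \<Rightarrow> 'a \<Rightarrow> ereal" where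
  "DY_envelope \<gamma> f h g x =
     (INF y. ereal (f x + grad f x \<bullet> (y - x) + h x + grad h x \<bullet> (y - x)) + g y
             + ereal (1 / (2 * \<gamma>) * (norm (y - x))\<^sup>2))"

definition asymptotically_regular :: "('a::real_normed_vector \<Rightarrow> 'a) \<Rightarrow> bool" where
  "asymptotically_regular S \<longleftrightarrow>
     (\<forall>u::nat \<Rightarrow> 'a. (\<forall>k. u (Suc k) = S (u k)) \<longrightarrow> (\<lambda>k. u k - S (u k)) \<longlonglongrightarrow> 0)"

definition cluster_point :: "(nat \<Rightarrow> 'a::topological_space) \<Rightarrow> 'a \<Rightarrow> bool" where
  "cluster_point x l \<longleftrightarrow> (\<exists>r::nat \<Rightarrow> nat. strict_mono r \<and> (x \<circ> r) \<longlonglongrightarrow> l)"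

definition frechet_subdifferential :: "('a::real_inner \<Rightarrow> ereal) \<Rightarrow> 'a \<Rightarrow> 'a set" where
  "frechet_subdifferential \<phi> x =
     {v. \<bar>\<phi> x\<bar> \<noteq> \<infinity> \<and>
         0 \<le> Liminf (at x) (\<lambda>y. (\<phi> y - \<phi> x - ereal (v \<bullet> (y - x))) / ereal (norm (y - x)))}"

definition limiting_subdifferential :: "('a::real_inner \<Rightarrow> ereal) \<Rightarrow> 'a \<Rightarrow> 'a set" where
  "limiting_subdifferential \<phi> x =
     {v. \<bar>\<phi> x\<bar> \<noteq> \<infinity> \<and>
         (\<exists>xs vs. xs \<longlonglongrightarrow> x \<and> (\<lambda>n. \<phi> (xs n)) \<longlonglongrightarrow> \<phi> x \<and>
                  (\<forall>n::nat. vs n \<in> frechet_subdifferential \<phi> (xs n)) \<and> vs \<longlonglongrightarrow> v)}"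

definition stationary_point :: "('a::real_inner \<Rightarrow> ereal) \<Rightarrow> 'a \<Rightarrow> bool" where
  "stationary_point \<phi> x \<longleftrightarrow> 0 \<in> limiting_subdifferential \<phi> x"

definition stationary_value :: "('a::real_inner \<Rightarrow> ereal) \<Rightarrow> real \<Rightarrow> bool" where
  "stationary_value \<phi> v \<longleftrightarrow> (\<exists>x. stationary_point \<phi> x \<and> ereal v = \<phi> x)"

text \<open>The strictly positive root of a function that has exactly one, and \<open>0\<close> otherwise. For the two
  quadratics below and admissible parameters (\<open>L\<^sub>f, L\<^sub>h, \<rho>\<^sub>f \<ge> 0\<close>, \<open>0 < \<alpha> < 1\<close>, \<open>0 < lam\<close>,
  \<open>lam * \<alpha> < 2\<close>, and \<open>L\<^sub>f > \<rho>\<^sub>f\<close> for the first) there is exactly one, with a single exception: if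
  \<open>L\<^sub>f = L\<^sub>h = \<rho>\<^sub>f = 0\<close>, then \<open>step_poly_b\<close> is a positive multiple of \<open>\<eta>\<^sup>2\<close>, whose only root is \<open>0\<close>.\<close>

definition positive_root :: "(real \<Rightarrow> real) \<Rightarrow> real" where
  "positive_root p = (if \<exists>!t. 0 < t \<and> p t = 0 then THE t. 0 < t \<and> p t = 0 else 0)"

definition step_poly_a :: "real \<Rightarrow> real \<Rightarrow> real \<Rightarrow> real \<Rightarrow> real \<Rightarrow> real \<Rightarrow> real" where
  "step_poly_a L\<^sub>f L\<^sub>h \<rho>\<^sub>f \<alpha> lam t =
     - (L\<^sub>f\<^sup>2 / (lam * \<alpha>) + L\<^sub>f * L\<^sub>h / (lam * \<alpha>)) * t\<^sup>2
     - (2 * L\<^sub>f / (lam * \<alpha>) + (1 / 2 + \<bar>1 - lam * \<alpha>\<bar> / (lam * \<alpha>)) * L\<^sub>h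
        + \<rho>\<^sub>f * L\<^sub>f / (2 * (L\<^sub>f - \<rho>\<^sub>f)) - L\<^sub>f\<^sup>2 / (2 * (L\<^sub>f - \<rho>\<^sub>f))) * t
     + 1 / (lam * \<alpha>) - 1 / 2"

definition step_poly_b :: "real \<Rightarrow> real \<Rightarrow> real \<Rightarrow> real \<Rightarrow> real \<Rightarrow> real \<Rightarrow> real" where
  "step_poly_b L\<^sub>f L\<^sub>h \<rho>\<^sub>f \<alpha> lam \<eta> =
     4 * (1 / (lam * \<alpha>) - 1 / 2) * \<eta>\<^sup>2
     - 2 * (2 * L\<^sub>f / \<alpha> + (lam / 2 + \<bar>1 - lam * \<alpha>\<bar> / \<alpha>) * L\<^sub>h) * \<eta>
     - lam * (\<rho>\<^sub>f * (\<eta> + \<rho>\<^sub>f) + L\<^sub>f\<^sup>2 * ((1 - \<alpha>) / \<alpha>) + L\<^sub>f * L\<^sub>h / \<alpha>)"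

definition gamma_hat_plus :: "real \<Rightarrow> real \<Rightarrow> real \<Rightarrow> real \<Rightarrow> real \<Rightarrow> real" where
  "gamma_hat_plus L\<^sub>f L\<^sub>h \<rho>\<^sub>f \<alpha> lam = positive_root (step_poly_a L\<^sub>f L\<^sub>h \<rho>\<^sub>f \<alpha> lam)"

definition L_plus :: "real \<Rightarrow> real \<Rightarrow> real \<Rightarrow> real \<Rightarrow> real \<Rightarrow> real" where
  "L_plus L\<^sub>f L\<^sub>h \<rho>\<^sub>f \<alpha> lam = max L\<^sub>f (positive_root (step_poly_b L\<^sub>f L\<^sub>h \<rho>\<^sub>f \<alpha> lam) + \<rho>\<^sub>f)"

text \<open>On \<open>ereal\<close>, \<open>1 / 0 = \<infinity>\<close>. So \<open>gamma_hat_at\<close> is \<open>\<infinity>\<close> at \<open>L = \<rho>\<^sub>f\<close>, which for \<open>L = L_plus\<close>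
  happens only in the exceptional case above.\<close>

definition gamma_hat_at :: "real \<Rightarrow> real \<Rightarrow> real \<Rightarrow> ereal" where
  "gamma_hat_at \<rho>\<^sub>f lam L = ereal lam / ereal (2 * (L - \<rho>\<^sub>f))"

text \<open>The number \<open>\<gamma>\<^sub>0\<close> is the freely chosen constant with \<open>\<gamma>\<^sub>0 \<ge> lam / (2 * (L\<^sub>f - \<rho>\<^sub>f))\<close>.\<close>

definition stepsize_bound :: "real \<Rightarrow> real \<Rightarrow> real \<Rightarrow> real \<Rightarrow> real \<Rightarrow> real \<Rightarrow> ereal" where
  "stepsize_bound \<gamma>\<^sub>0 L\<^sub>f L\<^sub>h \<rho>\<^sub>f \<alpha> lam =
     (if L\<^sub>f > \<rho>\<^sub>f
      then Min {ereal (gamma_hat_plus L\<^sub>f L\<^sub>h \<rho>\<^sub>f \<alpha> lam), ereal \<gamma>\<^sub>0,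
                gamma_hat_at \<rho>\<^sub>f lam (L_plus L\<^sub>f L\<^sub>h \<rho>\<^sub>f \<alpha> lam)}
      else gamma_hat_at \<rho>\<^sub>f lam (L_plus L\<^sub>f L\<^sub>h \<rho>\<^sub>f \<alpha> lam))"

end

(* The envelope at x is attained at Y x, and it dominates phi (Y x) because gamma * (L_f + L_h) < 1.
   Testing the infimum at x' = DY x with the old point Y x bounds the change of the envelope by
   Bregman distances and inner products of gradient differences. With eta = lam / (2 * gamma), the
   polynomial step_poly_b at eta, divided by 2 * lam * eta, is exactly the resulting decrease
   constant in front of |x' - x|^2. It is positive because gamma < gamma_hat_at at L_plus means
   that eta exceeds the positive root. Hence x^{k+1} - x^k and Y x^k - x^k tend to 0, level-boundedness of phi bounds the iterates, and the vectors
   grad F(y) - grad F(x) - (y - x) / gamma, with F = f + h and y = Y x, are Frechet subgradients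
   of phi at y that tend to 0. *)

theory Submission
  imports Defs
begin

section \<open>Smooth and weakly convex functions\<close>

lemma GDERIV_unique:
  assumes "GDERIV f x :> D" "GDERIV f x :> D'"
  shows "D = D'"
  using has_derivative_unique[OF assms[unfolded gderiv_def]]
  by (metis vector_eq_ldot)

lemma GDERIV_grad:
  fixes f :: "'a::euclidean_space \<Rightarrow> real"
  assumes "f differentiable (at x)"
  shows "GDERIV f x :> grad f x"
proof -
  obtain D where D: "(f has_derivative D) (at x)"
    using assms by (auto simp: differentiable_def)
  \<comment> \<open>The adjoint of the linear functional \<open>D\<close>, evaluated at 1, is the
    vector that represents it.\<close>
  have D_eq: "D = (\<lambda>y. y \<bullet> adjoint D 1)"
    using adjoint_works[OF has_derivative_linear[OF D], of _ 1] by (simp add: fun_eq_iff)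
  have "GDERIV f x :> adjoint D 1"
    unfolding gderiv_def by (subst D_eq[symmetric]) (rule D)
  moreover have "D' = adjoint D 1" if "GDERIV f x :> D'" for D'
    using that calculation by (rule GDERIV_unique)
  ultimately show ?thesis
    unfolding grad_def by (rule theI)
qed

lemma grad_eqI:
  fixes f :: "'a::euclidean_space \<Rightarrow> real"
  assumes "GDERIV f x :> D"
  shows "grad f x = D"
  using assms GDERIV_grad GDERIV_unique
  by (metis differentiable_def gderiv_def)

lemma grad_add:
  fixes f h :: "'a::euclidean_space \<Rightarrow> real"
  assumes "f differentiable (at x)" "h differentiable (at x)"
  shows "grad (\<lambda>z. f z + h z) x = grad f x + grad h x"
  by (intro grad_eqI GDERIV_add GDERIV_grad assms)

section \<open>Quadratic bounds and tangents by restriction to a line\<close>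

lemma DERIV_along_line:
  fixes f :: "'a::euclidean_space \<Rightarrow> real"
  assumes "\<And>x. f differentiable (at x)"
  shows "((\<lambda>t. f (x + t *\<^sub>R d)) has_real_derivative grad f (x + t *\<^sub>R d) \<bullet> d) (at t)"
proof -
  have f': "(f has_derivative (\<lambda>y. y \<bullet> grad f (x + t *\<^sub>R d))) (at (x + t *\<^sub>R d))"
    using GDERIV_grad[OF assms] by (simp add: gderiv_def)
  have "((\<lambda>t. x + t *\<^sub>R d) has_derivative (\<lambda>s. s *\<^sub>R d)) (at t)"
    by (auto intro!: derivative_eq_intros)
  from has_derivative_compose[OF this f'] show ?thesis
    by (simp add: has_field_derivative_def inner_commute mult.commute[of _ "inner _ _"])
qed

text \<open>Descent lemma with a derivative test in place of an integral: along the segment, f minus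
  its linear part minus the quadratic has nonpositive derivative by Cauchy-Schwarz and the Lipschitz
  bound.\<close>

lemma lipschitz_grad_upper_bound:
  fixes f :: "'a::euclidean_space \<Rightarrow> real"
  assumes diff: "\<And>x. f differentiable (at x)" and lip: "L-lipschitz_on UNIV (grad f)"
  shows "f y \<le> f x + grad f x \<bullet> (y - x) + L / 2 * (norm (y - x))\<^sup>2"
proof -
  define d where "d = y - x"
  define \<psi> where "\<psi> t = f (x + t *\<^sub>R d) - t * (grad f x \<bullet> d) - L / 2 * t\<^sup>2 * (norm d)\<^sup>2" for t
  have "\<psi> 1 \<le> \<psi> 0"
  proof (rule DERIV_nonpos_imp_nonincreasing[of 0 1 \<psi>])
    fix t :: real assume t: "0 \<le> t" "t \<le> 1"
    have "(\<psi> has_real_derivative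
        grad f (x + t *\<^sub>R d) \<bullet> d - grad f x \<bullet> d - L * t * (norm d)\<^sup>2) (at t)"
      unfolding \<psi>_def by (auto intro!: derivative_eq_intros DERIV_along_line diff)
    moreover have "grad f (x + t *\<^sub>R d) \<bullet> d - grad f x \<bullet> d \<le> L * t * (norm d)\<^sup>2"
    proof -
      have "(grad f (x + t *\<^sub>R d) - grad f x) \<bullet> d \<le> norm (grad f (x + t *\<^sub>R d) - grad f x) * norm d"
        by (rule norm_cauchy_schwarz)
      also have "\<dots> \<le> (L * norm (t *\<^sub>R d)) * norm d"
        using lipschitz_onD[OF lip, of "x + t *\<^sub>R d" x]
        by (intro mult_right_mono) (auto simp: dist_norm)
      finally show ?thesis
        using t by (simp add: power2_eq_square inner_diff_left mult.assoc)
    qed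
    ultimately show "\<exists>z. DERIV \<psi> t :> z \<and> z \<le> 0"
      by (intro exI conjI) auto
  qed simp
  then show ?thesis
    by (simp add: \<psi>_def d_def)
qed

text \<open>The gradient of -f has the same Lipschitz constant, so the upper bound for -f
  applies.\<close>

lemma lipschitz_grad_lower_bound:
  fixes f :: "'a::euclidean_space \<Rightarrow> real"
  assumes diff: "\<And>x. f differentiable (at x)" and lip: "L-lipschitz_on UNIV (grad f)"
  shows "f x + grad f x \<bullet> (y - x) - L / 2 * (norm (y - x))\<^sup>2 \<le> f y"
proof -
  have grad: "grad (\<lambda>z. - f z) = (\<lambda>z. - grad f z)"
    by (intro ext grad_eqI GDERIV_minus GDERIV_grad diff)
  have "L-lipschitz_on UNIV (grad (\<lambda>z. - f z))"
    unfolding grad using lip by (auto simp: lipschitz_on_def dist_minus)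
  from lipschitz_grad_upper_bound[OF _ this, of y x] diff show ?thesis
    by (simp add: grad)
qed

lemma convex_above_tangent:
  fixes f :: "'a::euclidean_space \<Rightarrow> real"
  assumes conv: "convex_on UNIV f" and diff: "\<And>x. f differentiable (at x)"
  shows "f x + grad f x \<bullet> (y - x) \<le> f y"
proof -
  define \<psi> where "\<psi> t = f (x + t *\<^sub>R (y - x))" for t
  have "convex_on UNIV \<psi>"
  proof (rule convex_onI)
    fix t a b :: real assume t: "0 < t" "t < 1"
    have "x + ((1 - t) *\<^sub>R a + t *\<^sub>R b) *\<^sub>R (y - x) =
        (1 - t) *\<^sub>R (x + a *\<^sub>R (y - x)) + t *\<^sub>R (x + b *\<^sub>R (y - x))"
      by (simp add: algebra_simps)
    then show "\<psi> ((1 - t) *\<^sub>R a + t *\<^sub>R b) \<le> (1 - t) * \<psi> a + t * \<psi> b"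
      unfolding \<psi>_def using convex_onD[OF conv, of t] t by simp
  qed simp
  moreover have "(\<psi> has_real_derivative grad f x \<bullet> (y - x)) (at 0 within UNIV)"
    unfolding \<psi>_def using DERIV_along_line[OF diff, of x "y - x" 0] by simp
  ultimately have "\<psi> 1 - \<psi> 0 \<ge> grad f x \<bullet> (y - x) * (1 - 0)"
    by (intro convex_on_imp_above_tangent[of UNIV]) auto
  then show ?thesis
    by (simp add: \<psi>_def)
qed

lemma norm_sq_expand:
  fixes x y z :: "'a::real_inner"
  shows "(norm (y - x))\<^sup>2 = (norm (z - x))\<^sup>2 + 2 * ((z - x) \<bullet> (y - z)) + (norm (y - z))\<^sup>2"
  by (simp add: power2_norm_eq_inner algebra_simps inner_commute)

text \<open>Tangent inequality for the convexified function; expanding |y|^2 around x cancels the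
  extra gradient \<open>\<rho> *\<^sub>R x\<close> and leaves a multiple of |y - x|^2.\<close>

lemma weakly_convex_above_tangent:
  fixes f :: "'a::euclidean_space \<Rightarrow> real"
  assumes wc: "weakly_convex \<rho> f" and diff: "\<And>x. f differentiable (at x)"
  shows "f x + grad f x \<bullet> (y - x) - \<rho> / 2 * (norm (y - x))\<^sup>2 \<le> f y"
proof -
  let ?F = "\<lambda>x. f x + \<rho> / 2 * (norm x)\<^sup>2"
  have F': "GDERIV ?F x :> grad f x + \<rho> *\<^sub>R x" for x
  proof -
    have "GDERIV (\<lambda>x. \<rho> / 2 * (norm x)\<^sup>2) x :> \<rho> *\<^sub>R x"
      unfolding gderiv_def power2_norm_eq_inner
      by (auto intro!: derivative_eq_intros simp: inner_commute)
    then show ?thesis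
      by (intro GDERIV_add GDERIV_grad diff)
  qed
  have "?F x + grad ?F x \<bullet> (y - x) \<le> ?F y"
    using wc F' by (intro convex_above_tangent)
      (auto simp: weakly_convex_def differentiable_def gderiv_def)
  moreover have "(norm y)\<^sup>2 = (norm x)\<^sup>2 + 2 * (x \<bullet> (y - x)) + (norm (y - x))\<^sup>2"
    using norm_sq_expand[of y 0 x] by simp
  ultimately show ?thesis
    by (simp only: grad_eqI[OF F'] inner_add_left inner_scaleR_left) (simp add: distrib_left)
qed

text \<open>Interpolation inequality for the convex function \<open>f + \<rho>/2 \<parallel>\<cdot>\<parallel>\<^sup>2\<close>: compare its tangent at \<open>y\<close> with
  its quadratic upper bound at \<open>x\<close>, both evaluated after a gradient step from \<open>x\<close>.\<close>

lemma bregman_interpolation: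
  fixes f :: "'a::euclidean_space \<Rightarrow> real"
  assumes diff: "\<And>x. f differentiable (at x)" and lip: "L-lipschitz_on UNIV (grad f)"
    and wc: "weakly_convex \<rho> f" and pos: "0 < L + \<rho>"
  shows "(norm (grad f x - grad f y + \<rho> *\<^sub>R (x - y)))\<^sup>2 / (2 * (L + \<rho>)) - \<rho> / 2 * (norm (x - y))\<^sup>2
    \<le> f x - f y - grad f y \<bullet> (x - y)"
proof -
  define e where "e = grad f x - grad f y + \<rho> *\<^sub>R (x - y)"
  \<comment> \<open>This z maximises - e . (z - x) - (L + \<rho>)/2 |z - x|^2, the expression that
    bounds the Bregman distance below.\<close>
  define z where "z = x - (1 / (L + \<rho>)) *\<^sub>R e"
  have zx: "z - x = - (1 / (L + \<rho>)) *\<^sub>R e"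
    by (simp add: z_def)
  have "f y + grad f y \<bullet> (z - y) - \<rho> / 2 * (norm (z - y))\<^sup>2 \<le> f z"
    by (rule weakly_convex_above_tangent[OF wc diff])
  also have "f z \<le> f x + grad f x \<bullet> (z - x) + L / 2 * (norm (z - x))\<^sup>2"
    by (rule lipschitz_grad_upper_bound[OF diff lip])
  finally have "f y + grad f y \<bullet> ((z - x) + (x - y)) - \<rho> / 2 * (norm (z - y))\<^sup>2
      - grad f x \<bullet> (z - x) - L / 2 * (norm (z - x))\<^sup>2 \<le> f x"
    by simp
  moreover have "(norm (z - y))\<^sup>2 = (norm (x - y))\<^sup>2 + 2 * ((x - y) \<bullet> (z - x)) + (norm (z - x))\<^sup>2"
    by (rule norm_sq_expand)
  moreover have "e \<bullet> (z - x) = grad f x \<bullet> (z - x) - grad f y \<bullet> (z - x) + \<rho> * ((x - y) \<bullet> (z - x))"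
    by (simp add: e_def inner_add_left inner_diff_left)
  ultimately have "- (e \<bullet> (z - x)) - (L + \<rho>) / 2 * (norm (z - x))\<^sup>2 - \<rho> / 2 * (norm (x - y))\<^sup>2
      \<le> f x - f y - grad f y \<bullet> (x - y)"
    by (simp only: inner_add_right) argo
  moreover have "- (e \<bullet> (z - x)) - (L + \<rho>) / 2 * (norm (z - x))\<^sup>2 = (norm e)\<^sup>2 / (2 * (L + \<rho>))"
  proof -
    have "e \<bullet> (z - x) = - ((norm e)\<^sup>2 / (L + \<rho>))"
      by (simp add: zx power2_norm_eq_inner)
    moreover have "(norm (z - x))\<^sup>2 = (norm e)\<^sup>2 / (L + \<rho>)\<^sup>2"
      by (simp add: zx power_divide)
    moreover have "E / M - M / 2 * (E / M\<^sup>2) = E / (2 * M)" if "0 < M" for E M :: real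
      using that by (simp add: field_simps power2_eq_square)
    ultimately show ?thesis
      using pos by simp
  qed
  ultimately show ?thesis
    by (simp add: e_def)
qed

text \<open>The interpolation inequality is used in both directions: one direction bounds the
  Bregman distance B in terms of P, their sum bounds P alone, and a weighted combination eliminates
  P.\<close>

lemma bregman_lower_bound:
  fixes f :: "'a::euclidean_space \<Rightarrow> real"
  assumes diff: "\<And>x. f differentiable (at x)" and lip: "L-lipschitz_on UNIV (grad f)"
    and wc: "weakly_convex \<rho> f" and rho: "0 \<le> \<rho>" "\<rho> < L"
  shows "((norm (grad f x - grad f y))\<^sup>2 - \<rho> * L * (norm (x - y))\<^sup>2) / (2 * (L - \<rho>))
    \<le> f x - f y - grad f y \<bullet> (x - y)"
proof -
  define v d where "v = grad f x - grad f y" and "d = x - y"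
  define V P D where "V = (norm v)\<^sup>2" and "P = v \<bullet> d" and "D = (norm d)\<^sup>2"
  define B where "B = f x - f y - grad f y \<bullet> (x - y)"
  have sq: "(norm (v + \<rho> *\<^sub>R d))\<^sup>2 = V + 2 * \<rho> * P + \<rho>\<^sup>2 * D"
    unfolding V_def P_def D_def power2_norm_eq_inner
    by (simp add: inner_add_left inner_add_right inner_commute[of d v] power2_eq_square algebra_simps)
  have 1: "(V + 2 * \<rho> * P + \<rho>\<^sup>2 * D) / (2 * (L + \<rho>)) - \<rho> / 2 * D \<le> B"
    using bregman_interpolation[OF diff lip wc, of x y] rho sq by (simp add: v_def d_def D_def B_def)
  have "norm (- v + \<rho> *\<^sub>R (- d)) = norm (v + \<rho> *\<^sub>R d)"
    by (metis minus_add_distrib norm_minus_cancel scaleR_minus_right)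
  then have "(V + 2 * \<rho> * P + \<rho>\<^sup>2 * D) / (2 * (L + \<rho>)) - \<rho> / 2 * D \<le> f y - f x - grad f x \<bullet> (y - x)"
    using bregman_interpolation[OF diff lip wc, of y x] rho sq
    by (simp add: v_def d_def D_def norm_minus_commute)
  also have "f y - f x - grad f x \<bullet> (y - x) = P - B"
    by (simp add: P_def B_def v_def d_def algebra_simps)
  finally have 2: "(V + 2 * \<rho> * P + \<rho>\<^sup>2 * D) / (2 * (L + \<rho>)) - \<rho> / 2 * D \<le> P - B" .
  have B1: "V + 2 * \<rho> * P + \<rho>\<^sup>2 * D - \<rho> * (L + \<rho>) * D \<le> 2 * (L + \<rho>) * B"
    using 1 rho by (simp add: field_simps)
  \<comment> \<open>Sum of both directions, in which B drops out; it amounts to V - \<rho> L D \<le>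
    (L - \<rho>) P.\<close>
  have B2: "V + 2 * \<rho> * P + \<rho>\<^sup>2 * D - \<rho> * (L + \<rho>) * D \<le> (L + \<rho>) * P"
    using 1 2 rho by (simp add: field_simps)
  \<comment> \<open>The weights L - \<rho> and 2 \<rho> make P cancel and leave a common factor L +
    \<rho>.\<close>
  have "(L - \<rho>) * (V + 2 * \<rho> * P - \<rho> * L * D) \<le> (L - \<rho>) * (2 * (L + \<rho>) * B)"
    using B1 rho by (intro mult_left_mono) (auto simp: algebra_simps power2_eq_square)
  moreover have "2 * \<rho> * (V - \<rho> * L * D) \<le> 2 * \<rho> * ((L - \<rho>) * P)"
    using B2 rho by (intro mult_left_mono) (auto simp: algebra_simps power2_eq_square)
  ultimately have "(L + \<rho>) * (V - \<rho> * L * D) \<le> (L + \<rho>) * (2 * (L - \<rho>) * B)"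
    by (simp add: algebra_simps power2_eq_square)
  then have "V - \<rho> * L * D \<le> 2 * (L - \<rho>) * B"
    using rho by (simp add: mult_le_cancel_left_pos)
  then show ?thesis
    using rho by (simp add: V_def D_def B_def v_def d_def pos_divide_le_eq mult.commute)
qed

section \<open>The proximal steps\<close>

text \<open>The optimality condition is a fixed-point equation for a contraction with factor
  \<gamma> L, which yields w. The proximal objective grows quadratically away from w, so w is its
  only minimiser.\<close>

lemma prox_smooth:
  fixes f :: "'a::euclidean_space \<Rightarrow> real"
  assumes diff: "\<And>x. f differentiable (at x)" and lip: "L-lipschitz_on UNIV (grad f)"
    and \<gamma>: "0 < \<gamma>" "\<gamma> * L < 1"
  obtains w where "prox \<gamma> (\<lambda>z. ereal (f z)) z = {w}" "w + \<gamma> *\<^sub>R grad f w = z"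
proof -
  have L0: "0 \<le> L"
    using lip by (simp add: lipschitz_on_def)
  have "\<exists>!w\<in>UNIV. z - \<gamma> *\<^sub>R grad f w = w"
  proof (rule Banach_fix)
    show "0 \<le> \<gamma> * L" "\<gamma> * L < 1" using \<gamma> L0 by auto
    fix x y
    have "dist (z - \<gamma> *\<^sub>R grad f x) (z - \<gamma> *\<^sub>R grad f y) = \<gamma> * dist (grad f x) (grad f y)"
      using \<gamma> by (simp add: dist_norm norm_minus_commute flip: scaleR_diff_right)
    also have "\<dots> \<le> \<gamma> * L * dist x y"
      using \<gamma> lipschitz_onD[OF lip, of x y] by (simp add: mult.assoc)
    finally show "dist (z - \<gamma> *\<^sub>R grad f x) (z - \<gamma> *\<^sub>R grad f y) \<le> \<gamma> * L * dist x y" .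
  qed (auto simp: complete_UNIV)
  then obtain w where w: "z - \<gamma> *\<^sub>R grad f w = w" by auto
  let ?\<Phi> = "\<lambda>y. f y + 1 / (2 * \<gamma>) * (norm (y - z))\<^sup>2"
  \<comment> \<open>The curvature of the proximal term less the most negative curvature that f can
    have.\<close>
  define c where "c = 1 / (2 * \<gamma>) - L / 2"
  have c: "c > 0"
    using \<gamma> by (simp add: c_def field_simps)
  have strong: "?\<Phi> w + c * (norm (y - w))\<^sup>2 \<le> ?\<Phi> y" for y
  proof -
    have "w - z = - \<gamma> *\<^sub>R grad f w"
      using w by (metis add_diff_cancel_left' diff_add_cancel minus_diff_eq scaleR_minus_left)
    then have "1 / (2 * \<gamma>) * (2 * ((w - z) \<bullet> (y - w))) = - (grad f w \<bullet> (y - w))"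
      using \<gamma> by simp
    then have "1 / (2 * \<gamma>) * (norm (y - z))\<^sup>2 =
        1 / (2 * \<gamma>) * (norm (w - z))\<^sup>2 - grad f w \<bullet> (y - w) + 1 / (2 * \<gamma>) * (norm (y - w))\<^sup>2"
      by (subst norm_sq_expand[of y z w], simp only: distrib_left)
    then show ?thesis
      using lipschitz_grad_lower_bound[OF diff lip, of w y] by (simp add: c_def algebra_simps)
  qed
  have "prox \<gamma> (\<lambda>z. ereal (f z)) z = {w}"
  proof (intro equalityI subsetI)
    fix y assume "y \<in> prox \<gamma> (\<lambda>z. ereal (f z)) z"
    then have "?\<Phi> y \<le> ?\<Phi> w"
      by (simp add: prox_def minimisers_def)
    then have "c * (norm (y - w))\<^sup>2 \<le> 0"
      using strong[of y] by linarith
    then show "y \<in> {w}"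
      using c by (simp add: mult_le_0_iff)
  next
    fix y assume "y \<in> {w}"
    moreover have "?\<Phi> w \<le> ?\<Phi> y" for y
      using strong[of y] c by (smt (verit) mult_nonneg_nonneg zero_le_power2)
    ultimately show "y \<in> prox \<gamma> (\<lambda>z. ereal (f z)) z"
      by (simp add: prox_def minimisers_def)
  qed
  with w that show ?thesis by (metis diff_add_cancel)
qed


text \<open>The envelope objective without g; being real-valued, it confines extended-real
  arithmetic to the addition of g.\<close>

definition quad_model :: "real \<Rightarrow> ('a::real_inner \<Rightarrow> real) \<Rightarrow> 'a \<Rightarrow> 'a \<Rightarrow> real" where
  "quad_model \<gamma> F x y = F x + grad F x \<bullet> (y - x) + 1 / (2 * \<gamma>) * (norm (y - x))\<^sup>2"

text \<open>Completing the square: the proximal objective at the gradient step differs from g plus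
  the model by the constant c, which does not depend on z.\<close>

lemma forward_backward_minimises:
  assumes \<gamma>: "0 < \<gamma>" and y: "y \<in> prox \<gamma> g (x - \<gamma> *\<^sub>R grad F x)"
  shows "g y + ereal (quad_model \<gamma> F x y) \<le> g z + ereal (quad_model \<gamma> F x z)"
proof -
  define c where "c = F x - \<gamma> / 2 * (norm (grad F x))\<^sup>2"
  have sq: "1 / (2 * \<gamma>) * (norm (z - (x - \<gamma> *\<^sub>R grad F x)))\<^sup>2 + c = quad_model \<gamma> F x z" for z
  proof -
    have "(norm (z - (x - \<gamma> *\<^sub>R grad F x)))\<^sup>2
        = \<gamma>\<^sup>2 * (norm (grad F x))\<^sup>2 + 2 * \<gamma> * (grad F x \<bullet> (z - x)) + (norm (z - x))\<^sup>2"
      by (subst norm_sq_expand[of z _ x]) (simp add: power_mult_distrib)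
    then show ?thesis
      using \<gamma> by (simp add: quad_model_def c_def field_simps power2_eq_square)
  qed
  have "g y + ereal (1 / (2 * \<gamma>) * (norm (y - (x - \<gamma> *\<^sub>R grad F x)))\<^sup>2) + ereal c
      \<le> g z + ereal (1 / (2 * \<gamma>) * (norm (z - (x - \<gamma> *\<^sub>R grad F x)))\<^sup>2) + ereal c"
    using y by (intro add_right_mono) (simp add: prox_def minimisers_def)
  then show ?thesis
    by (simp only: add.assoc plus_ereal.simps sq)
qed

lemma forward_backward_finite:
  assumes "proper g" and \<gamma>: "0 < \<gamma>" and y: "y \<in> prox \<gamma> g (x - \<gamma> *\<^sub>R grad F x)"
  shows "\<bar>g y\<bar> \<noteq> \<infinity>"
proof -
  obtain z where z: "g z \<noteq> \<infinity>" and minf: "\<And>z. g z \<noteq> -\<infinity>"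
    using \<open>proper g\<close> by (auto simp: proper_def)
  show ?thesis
    using forward_backward_minimises[OF \<gamma> y, of z] z minf[of y] minf[of z]
    by (cases "g y"; cases "g z") auto
qed

lemma DY_envelope_eq:
  fixes f h :: "'a::euclidean_space \<Rightarrow> real"
  assumes diff: "f differentiable (at x)" "h differentiable (at x)" and \<gamma>: "0 < \<gamma>"
    and y: "y \<in> prox \<gamma> g (x - \<gamma> *\<^sub>R grad (\<lambda>z. f z + h z) x)"
  shows "DY_envelope \<gamma> f h g x = g y + ereal (quad_model \<gamma> (\<lambda>z. f z + h z) x y)"
proof -
  have "ereal (f x + grad f x \<bullet> (z - x) + h x + grad h x \<bullet> (z - x)) + g z
      + ereal (1 / (2 * \<gamma>) * (norm (z - x))\<^sup>2)
      = g z + ereal (quad_model \<gamma> (\<lambda>z. f z + h z) x z)" for z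
    unfolding quad_model_def grad_add[OF diff] inner_add_left
    by (cases "g z") (simp_all add: algebra_simps)
  then have "DY_envelope \<gamma> f h g x = (INF z. g z + ereal (quad_model \<gamma> (\<lambda>z. f z + h z) x z))"
    by (simp add: DY_envelope_def)
  also have "\<dots> = g y + ereal (quad_model \<gamma> (\<lambda>z. f z + h z) x y)"
    by (intro antisym INF_lower INF_greatest forward_backward_minimises[OF \<gamma> y] UNIV_I)
  finally show ?thesis .
qed

section \<open>Descent of the envelope\<close>

lemma positive_root_nonneg: "0 \<le> positive_root p"
proof (cases "\<exists>!t. 0 < t \<and> p t = 0")
  case True
  from theI'[OF this] True show ?thesis
    by (simp add: positive_root_def)
qed (simp add: positive_root_def)

text \<open>The quotient p t / t = A t - B - C / t is strictly increasing for t > 0. Hence a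
  positive root is unique and p is positive beyond it.\<close>

lemma quadratic_pos_beyond_positive_root:
  fixes A B C :: real
  defines "p \<equiv> \<lambda>t. A * t\<^sup>2 - B * t - C"
  assumes A: "0 < A" and B: "0 \<le> B" and C: "0 \<le> C" and \<eta>: "positive_root p < \<eta>"
  shows "0 < p \<eta>"
proof (cases "B = 0 \<and> C = 0")
  \<comment> \<open>Here p t = A t^2 has no positive root, so \<open>positive_root p\<close> is its
    default 0.\<close>
  case True
  have "0 < \<eta>"
    using positive_root_nonneg[of p] \<eta> by linarith
  with True A show ?thesis
    by (simp add: p_def)
next
  case False
  \<comment> \<open>Monotonicity of p t / t with the denominators cleared.\<close>
  have star: "r * p s < s * p r" if "0 < s" "s < r" for s r
  proof -
    have "s * p r - r * p s = (r - s) * (A * r * s + C)"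
      by (simp add: p_def algebra_simps power2_eq_square)
    moreover have "0 < (r - s) * (A * r * s + C)"
      using that A C by (intro mult_pos_pos add_pos_nonneg) auto
    ultimately show ?thesis by linarith
  qed
  \<comment> \<open>The larger root of the quadratic formula, positive because B and C do not both
    vanish.\<close>
  define t where "t = (B + sqrt (B\<^sup>2 + 4 * A * C)) / (2 * A)"
  have "0 < B\<^sup>2 + 4 * A * C"
  proof (cases "B = 0")
    case True
    with False A C show ?thesis by simp
  next
    case False
    then have "0 < B\<^sup>2" by simp
    moreover have "0 \<le> 4 * A * C" using A C by simp
    ultimately show ?thesis by linarith
  qed
  then have t: "0 < t"
    using A B unfolding t_def by (intro divide_pos_pos add_nonneg_pos) auto
  have "2 * A * t - B = sqrt (B\<^sup>2 + 4 * A * C)"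
    using A by (simp add: t_def)
  then have "(2 * A * t - B)\<^sup>2 = B\<^sup>2 + 4 * A * C"
    using \<open>0 < B\<^sup>2 + 4 * A * C\<close> by simp
  then have "4 * A * p t = 0"
    by (simp add: p_def algebra_simps power2_eq_square)
  then have pt: "p t = 0"
    using A by simp
  have uniq: "s = t" if "0 < s" "p s = 0" for s
    using star[of s t] star[of t s] that t pt by (cases s t rule: linorder_cases) auto
  then have "\<exists>!t. 0 < t \<and> p t = 0"
    using t pt by blast
  then have "positive_root p = t"
    using theI'[of "\<lambda>t. 0 < t \<and> p t = 0"] uniq by (auto simp: positive_root_def)
  then have "0 < t * p \<eta>"
    using star[of t \<eta>] t pt \<eta> by simp
  then show ?thesis
    using t by (simp add: zero_less_mult_iff)
qed

text \<open>Since L = \<eta> + \<open>\<rho>\<^sub>f\<close> is already substituted, the term in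
  \<open>\<rho>\<^sub>f * L\<close> splits between the linear and the constant coefficient. The
  leading one is positive as lam * \<alpha> < 2.\<close>

lemma step_poly_b_pos:
  assumes nonneg: "0 \<le> L\<^sub>f" "0 \<le> L\<^sub>h" "0 \<le> \<rho>\<^sub>f" and \<alpha>: "0 < \<alpha>" "\<alpha> < 1"
    and lam: "0 < lam" "lam * \<alpha> < 2"
    and \<eta>: "positive_root (step_poly_b L\<^sub>f L\<^sub>h \<rho>\<^sub>f \<alpha> lam) < \<eta>"
  shows "0 < step_poly_b L\<^sub>f L\<^sub>h \<rho>\<^sub>f \<alpha> lam \<eta>"
proof -
  define A where "A = 4 * (1 / (lam * \<alpha>) - 1 / 2)"
  define B where "B = 2 * (2 * L\<^sub>f / \<alpha> + (lam / 2 + \<bar>1 - lam * \<alpha>\<bar> / \<alpha>) * L\<^sub>h) + lam * \<rho>\<^sub>f"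
  define C where "C = lam * (\<rho>\<^sub>f * \<rho>\<^sub>f + L\<^sub>f\<^sup>2 * ((1 - \<alpha>) / \<alpha>) + L\<^sub>f * L\<^sub>h / \<alpha>)"
  have eq: "step_poly_b L\<^sub>f L\<^sub>h \<rho>\<^sub>f \<alpha> lam = (\<lambda>t. A * t\<^sup>2 - B * t - C)"
    by (rule ext) (unfold step_poly_b_def A_def B_def C_def, algebra)
  have "0 < A"
    using \<alpha> lam by (simp add: A_def field_simps)
  moreover have "0 \<le> B" "0 \<le> C"
    using nonneg \<alpha> lam unfolding B_def C_def by auto
  ultimately show ?thesis
    using quadratic_pos_beyond_positive_root[of A B C \<eta>] \<eta> unfolding eq by blast
qed

lemma stepsize_above_thresholds:
  assumes \<gamma>: "0 < \<gamma>" "ereal \<gamma> < stepsize_bound \<gamma>\<^sub>0 L\<^sub>f L\<^sub>h \<rho>\<^sub>f \<alpha> lam" and lam: "0 < lam"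
  shows "L\<^sub>f < lam / (2 * \<gamma>) + \<rho>\<^sub>f"
    and "positive_root (step_poly_b L\<^sub>f L\<^sub>h \<rho>\<^sub>f \<alpha> lam) < lam / (2 * \<gamma>)"
proof -
  define L where "L = L_plus L\<^sub>f L\<^sub>h \<rho>\<^sub>f \<alpha> lam"
  have "ereal \<gamma> < gamma_hat_at \<rho>\<^sub>f lam L"
    using \<gamma> by (auto simp: stepsize_bound_def L_def split: if_splits)
  moreover have "\<rho>\<^sub>f \<le> L"
    using positive_root_nonneg[of "step_poly_b L\<^sub>f L\<^sub>h \<rho>\<^sub>f \<alpha> lam"] by (simp add: L_def L_plus_def)
  \<comment> \<open>At \<open>L = \<rho>\<^sub>f\<close> the bound on \<gamma> is infinite and the
    claim reduces to 0 < lam / (2 * \<gamma>).\<close>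
  ultimately have "L - \<rho>\<^sub>f < lam / (2 * \<gamma>)"
    using \<gamma> lam by (cases "L = \<rho>\<^sub>f") (auto simp: gamma_hat_at_def field_simps)
  then show "L\<^sub>f < lam / (2 * \<gamma>) + \<rho>\<^sub>f"
    and "positive_root (step_poly_b L\<^sub>f L\<^sub>h \<rho>\<^sub>f \<alpha> lam) < lam / (2 * \<gamma>)"
    by (auto simp: L_def L_plus_def)
qed

lemma inner_abs_le_norm_bounds:
  fixes a b :: "'a::real_inner"
  assumes "norm a \<le> A" "norm b \<le> B"
  shows "\<bar>a \<bullet> b\<bar> \<le> A * B"
  using Cauchy_Schwarz_ineq2[of a b] mult_mono[OF assms] norm_ge_zero[of a] assms(1)
  by (smt (verit) norm_ge_zero)

text \<open>With \<open>\<eta> = lam / (2 \<gamma>)\<close> and \<open>L = \<eta> + \<rho>\<^sub>f\<close>, the term \<open>\<gamma> / lam * \<parallel>\<nabla>f x' - \<nabla>f x\<parallel>\<^sup>2\<close> is exactly absorbed by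
  the Bregman lower bound for \<open>f\<close>.\<close>

lemma DY_step_decrease:
  fixes f h :: "'a::euclidean_space \<Rightarrow> real"
  assumes f_diff: "\<And>x. f differentiable (at x)" and h_diff: "\<And>x. h differentiable (at x)"
    and f_lip: "L\<^sub>f-lipschitz_on UNIV (grad f)" and h_lip: "L\<^sub>h-lipschitz_on UNIV (grad h)"
    and wc: "weakly_convex \<rho>\<^sub>f f" and rho: "0 \<le> \<rho>\<^sub>f"
    and \<alpha>: "0 < \<alpha>" "\<alpha> < 1" and lam: "0 < lam" and \<eta>: "0 < \<eta>" "L\<^sub>f \<le> \<eta> + \<rho>\<^sub>f"
    and \<gamma>: "\<gamma> = lam / (2 * \<eta>)"
    and w: "w + \<gamma> *\<^sub>R grad f w = x + \<gamma> *\<^sub>R grad f x + lam *\<^sub>R (y - x)"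
    and x': "x' = x + \<alpha> *\<^sub>R (w - x)"
  shows "quad_model \<gamma> (\<lambda>z. f z + h z) x' y
      + step_poly_b L\<^sub>f L\<^sub>h \<rho>\<^sub>f \<alpha> lam \<eta> / (2 * lam * \<eta>) * (norm (x' - x))\<^sup>2
    \<le> quad_model \<gamma> (\<lambda>z. f z + h z) x y"
proof -
  define d u where "d = x' - x" and "u = y - x"
  \<comment> \<open>The change of grad f from x to w is split at x' into v and r.\<close>
  define v r k where "v = grad f x' - grad f x" and "r = grad f w - grad f x'"
    and "k = grad h x' - grad h x"
  define N where "N = norm d"
  define D where "D = N\<^sup>2"
  have \<gamma>0: "0 < \<gamma>"
    using lam \<eta> by (simp add: \<gamma>)
  have wx: "w - x = (1 / \<alpha>) *\<^sub>R d"
    using \<alpha> by (simp add: d_def x')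
  have "w - x' = (w - x) - d"
    by (simp add: d_def)
  also have "\<dots> = ((1 - \<alpha>) / \<alpha>) *\<^sub>R d"
    using \<alpha> by (simp add: wx diff_divide_distrib scaleR_diff_left)
  finally have wx': "w - x' = ((1 - \<alpha>) / \<alpha>) *\<^sub>R d" .
  have v_le: "norm v \<le> L\<^sub>f * N"
    using lipschitz_onD[OF f_lip, of x' x] by (simp add: v_def N_def d_def dist_norm)
  have k_le: "norm k \<le> L\<^sub>h * N"
    using lipschitz_onD[OF h_lip, of x' x] by (simp add: k_def N_def d_def dist_norm)
  have r_le: "norm r \<le> L\<^sub>f * ((1 - \<alpha>) / \<alpha>) * N"
    using lipschitz_onD[OF f_lip, of w x'] \<alpha> by (simp add: r_def N_def dist_norm wx')
  have vr: "v + r = grad f w - grad f x"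
    by (simp add: v_def r_def)
  have vr_le: "norm (v + r) \<le> L\<^sub>f / \<alpha> * N"
    using lipschitz_onD[OF f_lip, of w x] \<alpha> by (simp add: vr N_def dist_norm wx)
  have "lam *\<^sub>R u = (w - x) + \<gamma> *\<^sub>R (grad f w - grad f x)"
    using w by (simp add: u_def algebra_simps)
  then have "lam *\<^sub>R u = (1 / \<alpha>) *\<^sub>R d + \<gamma> *\<^sub>R (v + r)"
    by (simp only: vr wx)
  then have u: "u = (1 / lam) *\<^sub>R ((1 / \<alpha>) *\<^sub>R d + \<gamma> *\<^sub>R (v + r))"
    using lam by (metis divide_self_if less_numeral_extra(3) mult_cancel_right1 scaleR_one scaleR_scaleR times_divide_eq_left)
  \<comment> \<open>Every product with u reduces to products with d and v + r, because \<gamma> /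
    lam = 1 / (2 * \<eta>).\<close>
  have ui: "a \<bullet> u = (a \<bullet> d) / (lam * \<alpha>) + (a \<bullet> (v + r)) / (2 * \<eta>)" for a
    using lam \<eta> by (simp add: u \<gamma> inner_add_right add_divide_distrib distrib_left)
  have bv: "\<bar>v \<bullet> d\<bar> \<le> L\<^sub>f * D" and bk: "\<bar>k \<bullet> d\<bar> \<le> L\<^sub>h * D" and br: "\<bar>v \<bullet> r\<bar> \<le> L\<^sub>f\<^sup>2 * ((1 - \<alpha>) / \<alpha>) * D"
    and bvr: "\<bar>(v + r) \<bullet> d\<bar> \<le> L\<^sub>f / \<alpha> * D" and bkr: "\<bar>k \<bullet> (v + r)\<bar> \<le> L\<^sub>f * L\<^sub>h / \<alpha> * D"
    using inner_abs_le_norm_bounds[OF v_le, of d N] inner_abs_le_norm_bounds[OF k_le, of d N]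
      inner_abs_le_norm_bounds[OF v_le r_le] inner_abs_le_norm_bounds[OF vr_le, of d N]
      inner_abs_le_norm_bounds[OF k_le vr_le]
    by (simp_all add: N_def D_def power2_eq_square mult_ac)
  \<comment> \<open>The constant \<open>\<eta> + \<rho>\<^sub>f\<close> is a valid Lipschitz
    constant, and its excess over \<open>\<rho>\<^sub>f\<close> is \<eta>; so |v|^2 gets the same
    coefficient here as in v . u.\<close>
  have breg: "((norm v)\<^sup>2 - \<rho>\<^sub>f * (\<eta> + \<rho>\<^sub>f) * D) / (2 * \<eta>) \<le> f x - f x' + grad f x' \<bullet> d"
  proof -
    have "(\<eta> + \<rho>\<^sub>f)-lipschitz_on UNIV (grad f)"
      using f_lip \<eta>(2) by (rule lipschitz_on_le)
    from bregman_lower_bound[OF f_diff this wc rho, of x x'] \<eta>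
    have "((norm (grad f x - grad f x'))\<^sup>2 - \<rho>\<^sub>f * (\<eta> + \<rho>\<^sub>f) * (norm (x - x'))\<^sup>2) / (2 * \<eta>)
        \<le> f x - f x' - grad f x' \<bullet> (x - x')"
      by simp
    moreover have "x - x' = - d" "grad f x - grad f x' = - v"
      by (simp_all add: d_def v_def)
    ultimately show ?thesis
      by (simp add: D_def N_def)
  qed
  have hb: "k \<bullet> d - L\<^sub>h / 2 * D \<le> h x - h x' + grad h x' \<bullet> d"
    using lipschitz_grad_upper_bound[OF h_diff h_lip, of x' x]
    by (simp add: k_def d_def D_def N_def inner_diff_left)
  have yx': "y - x' = u - d"
    by (simp add: u_def d_def)
  have grad: "grad (\<lambda>z. f z + h z) z = grad f z + grad h z" for z
    by (rule grad_add[OF f_diff h_diff])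
  have "(norm (u - d))\<^sup>2 = (norm u)\<^sup>2 - 2 * (d \<bullet> u) + D"
    by (simp add: D_def N_def power2_norm_eq_inner inner_diff_left inner_diff_right inner_commute)
  then have "1 / (2 * \<gamma>) * (norm u)\<^sup>2 - 1 / (2 * \<gamma>) * (norm (u - d))\<^sup>2 = (d \<bullet> u) / \<gamma> - D / (2 * \<gamma>)"
    using \<gamma>0 by (simp add: field_simps)
  then have total: "quad_model \<gamma> (\<lambda>z. f z + h z) x y - quad_model \<gamma> (\<lambda>z. f z + h z) x' y
      = (f x - f x' + grad f x' \<bullet> d) + (h x - h x' + grad h x' \<bullet> d)
        - v \<bullet> u - k \<bullet> u + (d \<bullet> u) / \<gamma> - D / (2 * \<gamma>)"
    unfolding quad_model_def grad yx' u_def[symmetric] v_def k_def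
    by (simp add: inner_add_left inner_diff_left inner_diff_right)
  have vu: "v \<bullet> u = (v \<bullet> d) / (lam * \<alpha>) + (norm v)\<^sup>2 / (2 * \<eta>) + (v \<bullet> r) / (2 * \<eta>)"
    unfolding ui by (simp add: inner_add_right power2_norm_eq_inner add_divide_distrib)
  have du: "(d \<bullet> u) / \<gamma> = 1 / (lam * \<alpha>) * (D / \<gamma>) + ((v + r) \<bullet> d) / lam"
  proof -
    have "(s / (lam * \<alpha>) + t / (2 * \<eta>)) / (lam / (2 * \<eta>)) = 1 / (lam * \<alpha>) * (s / (lam / (2 * \<eta>))) + t / lam"
      for s t
      using lam \<eta>(1) \<alpha>(1) by (simp add: field_simps)
    then show ?thesis
      unfolding ui \<gamma> inner_commute[of d "v + r"] D_def N_def power2_norm_eq_inner .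
  qed
  have c1: "(v \<bullet> d) / (lam * \<alpha>) \<le> L\<^sub>f / (lam * \<alpha>) * D"
    using bv lam \<alpha> by (simp add: divide_right_mono)
  have c2: "- (L\<^sub>f / (lam * \<alpha>) * D) \<le> ((v + r) \<bullet> d) / lam"
    using divide_right_mono[of "- (L\<^sub>f / \<alpha> * D)" "(v + r) \<bullet> d" lam] bvr lam
    by (simp add: mult.commute)
  \<comment> \<open>The k . d from the bound on h is merged with the one in k . u before taking
    absolute values; this produces |1 - lam * \<alpha>|.\<close>
  have c3: "k \<bullet> d / (lam * \<alpha>) - k \<bullet> d \<le> \<bar>1 - lam * \<alpha>\<bar> / (lam * \<alpha>) * L\<^sub>h * D"
  proof -
    have "k \<bullet> d / (lam * \<alpha>) - k \<bullet> d = (1 - lam * \<alpha>) / (lam * \<alpha>) * (k \<bullet> d)"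
      using lam \<alpha> by (simp add: field_simps)
    also have "\<dots> \<le> \<bar>(1 - lam * \<alpha>) / (lam * \<alpha>)\<bar> * \<bar>k \<bullet> d\<bar>"
      by (metis abs_ge_self abs_mult)
    also have "\<dots> \<le> \<bar>(1 - lam * \<alpha>) / (lam * \<alpha>)\<bar> * (L\<^sub>h * D)"
      using bk by (intro mult_left_mono) auto
    finally show ?thesis
      using lam \<alpha> by (simp add: mult.assoc)
  qed
  have c4: "(v \<bullet> r) / (2 * \<eta>) \<le> L\<^sub>f\<^sup>2 * ((1 - \<alpha>) / \<alpha>) * D / (2 * \<eta>)"
    using br \<eta> by (intro divide_right_mono) auto
  have c5: "(k \<bullet> (v + r)) / (2 * \<eta>) \<le> L\<^sub>f * L\<^sub>h / \<alpha> * D / (2 * \<eta>)"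
    using bkr \<eta> by (intro divide_right_mono) auto
  \<comment> \<open>The polynomial regrouped: after division by 2 lam \<eta>, H collects the terms
    free of \<eta> and Q those over 2 \<eta>.\<close>
  define Q where "Q = \<rho>\<^sub>f * (\<eta> + \<rho>\<^sub>f) + L\<^sub>f\<^sup>2 * ((1 - \<alpha>) / \<alpha>) + L\<^sub>f * L\<^sub>h / \<alpha>"
  define H where "H = 2 * (L\<^sub>f / (lam * \<alpha>)) + L\<^sub>h / 2 + \<bar>1 - lam * \<alpha>\<bar> / (lam * \<alpha>) * L\<^sub>h"
  have sp: "step_poly_b L\<^sub>f L\<^sub>h \<rho>\<^sub>f \<alpha> lam \<eta>
      = 4 * (1 / (lam * \<alpha>) - 1 / 2) * \<eta>\<^sup>2 - 2 * (lam * H) * \<eta> - lam * Q"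
  proof -
    have "lam * H = 2 * L\<^sub>f / \<alpha> + (lam / 2 + \<bar>1 - lam * \<alpha>\<bar> / \<alpha>) * L\<^sub>h"
      using lam by (simp add: H_def distrib_left distrib_right)
    then show ?thesis
      by (simp add: step_poly_b_def Q_def)
  qed
  have "step_poly_b L\<^sub>f L\<^sub>h \<rho>\<^sub>f \<alpha> lam \<eta> / (2 * lam * \<eta>)
      = (1 / (lam * \<alpha>) - 1 / 2) * (2 * \<eta> / lam) - H - Q / (2 * \<eta>)"
  proof -
    have "(4 * c * \<eta>\<^sup>2 - 2 * (lam * H) * \<eta> - lam * Q) / (2 * lam * \<eta>) = c * (2 * \<eta> / lam) - H - Q / (2 * \<eta>)"
      for c
      using lam \<eta>(1) by (simp add: field_simps power2_eq_square)
    then show ?thesis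
      unfolding sp .
  qed
  moreover have "2 * \<eta> / lam = 1 / \<gamma>"
    using lam \<eta> by (simp add: \<gamma>)
  ultimately have kappa: "step_poly_b L\<^sub>f L\<^sub>h \<rho>\<^sub>f \<alpha> lam \<eta> / (2 * lam * \<eta>) * D
      = 1 / (lam * \<alpha>) * (D / \<gamma>) - D / (2 * \<gamma>) - H * D - Q * D / (2 * \<eta>)"
    by (simp add: left_diff_distrib diff_divide_distrib)
  have HD: "H * D = 2 * (L\<^sub>f / (lam * \<alpha>) * D) + L\<^sub>h / 2 * D + \<bar>1 - lam * \<alpha>\<bar> / (lam * \<alpha>) * L\<^sub>h * D"
    by (simp add: H_def distrib_right)
  have QD: "Q * D / (2 * \<eta>) = \<rho>\<^sub>f * (\<eta> + \<rho>\<^sub>f) * D / (2 * \<eta>)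
      + L\<^sub>f\<^sup>2 * ((1 - \<alpha>) / \<alpha>) * D / (2 * \<eta>) + L\<^sub>f * L\<^sub>h / \<alpha> * D / (2 * \<eta>)"
    by (simp only: Q_def distrib_right add_divide_distrib)
  have breg': "(norm v)\<^sup>2 / (2 * \<eta>) - \<rho>\<^sub>f * (\<eta> + \<rho>\<^sub>f) * D / (2 * \<eta>) \<le> f x - f x' + grad f x' \<bullet> d"
    using breg by (simp only: diff_divide_distrib)
  \<comment> \<open>The final estimate with every product abstracted to a real variable, so that it
    is linear. The bound \<open>b\<^sub>1\<close> occurs twice, for v . d and for (v + r) . d;
    \<open>s\<^sub>4\<close> is |v|^2 / (2 \<eta>) and cancels.\<close>
  have combine: "p\<^sub>1 - p\<^sub>2 - (2 * b\<^sub>1 + b\<^sub>2 + b\<^sub>3) - (b\<^sub>4 + b\<^sub>5 + b\<^sub>6)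
      \<le> t\<^sub>f + t\<^sub>h - (s\<^sub>1 + s\<^sub>4 + s\<^sub>5) - (s\<^sub>3 + s\<^sub>6) + (p\<^sub>1 + s\<^sub>2) - p\<^sub>2"
    if "s\<^sub>4 - b\<^sub>4 \<le> t\<^sub>f" "q - b\<^sub>2 \<le> t\<^sub>h" "s\<^sub>1 \<le> b\<^sub>1" "- b\<^sub>1 \<le> s\<^sub>2" "s\<^sub>3 - q \<le> b\<^sub>3" "s\<^sub>5 \<le> b\<^sub>5" "s\<^sub>6 \<le> b\<^sub>6"
    for p\<^sub>1 p\<^sub>2 q t\<^sub>f t\<^sub>h b\<^sub>1 b\<^sub>2 b\<^sub>3 b\<^sub>4 b\<^sub>5 b\<^sub>6 s\<^sub>1 s\<^sub>2 s\<^sub>3 s\<^sub>4 s\<^sub>5 s\<^sub>6 :: real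
    using that by linarith
  have "step_poly_b L\<^sub>f L\<^sub>h \<rho>\<^sub>f \<alpha> lam \<eta> / (2 * lam * \<eta>) * D
      \<le> quad_model \<gamma> (\<lambda>z. f z + h z) x y - quad_model \<gamma> (\<lambda>z. f z + h z) x' y"
    unfolding total kappa HD QD vu du ui[of k] by (rule combine[OF breg' hb c1 c2 c3 c4 c5])
  then show ?thesis
    by (simp add: D_def N_def d_def)
qed

text \<open>Solving the optimality relation for lam (y - x) and taking norms; vanishing steps thus
  force Y x - x to vanish.\<close>

lemma DY_residual_bound:
  fixes f :: "'a::euclidean_space \<Rightarrow> real"
  assumes lip: "L\<^sub>f-lipschitz_on UNIV (grad f)" and \<alpha>: "0 < \<alpha>" and lam: "0 < lam" and \<gamma>: "0 < \<gamma>"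
    and w: "w + \<gamma> *\<^sub>R grad f w = x + \<gamma> *\<^sub>R grad f x + lam *\<^sub>R (y - x)"
    and x': "x' = x + \<alpha> *\<^sub>R (w - x)"
  shows "norm (y - x) \<le> (1 + \<gamma> * L\<^sub>f) / (lam * \<alpha>) * norm (x' - x)"
proof -
  have "lam * norm (y - x) = norm (lam *\<^sub>R (y - x))"
    using lam by simp
  also have "lam *\<^sub>R (y - x) = (w - x) + \<gamma> *\<^sub>R (grad f w - grad f x)"
    using w by (simp add: algebra_simps)
  also have "norm \<dots> \<le> norm (w - x) + \<gamma> * norm (grad f w - grad f x)"
    using norm_triangle_ineq[of "w - x" "\<gamma> *\<^sub>R (grad f w - grad f x)"] \<gamma> by simp
  also have "\<dots> \<le> norm (w - x) + \<gamma> * (L\<^sub>f * norm (w - x))"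
    using lipschitz_onD[OF lip, of w x] \<gamma> by (simp add: dist_norm)
  also have "\<dots> = (1 + \<gamma> * L\<^sub>f) * norm (w - x)"
    by (simp add: algebra_simps)
  also have "norm (w - x) = norm (x' - x) / \<alpha>"
    using \<alpha> by (simp add: x')
  finally show ?thesis
    using lam \<alpha> by (simp add: field_simps)
qed

text \<open>E is decreasing and bounded below, hence convergent, and |d k|^2 is at most (E k - E (k
  + 1)) / \<kappa>, which tends to 0.\<close>

lemma sufficient_decrease_convergence:
  fixes E :: "nat \<Rightarrow> real" and d :: "nat \<Rightarrow> 'a::real_normed_vector"
  assumes \<kappa>: "0 < \<kappa>" and dec: "\<And>k. E (Suc k) + \<kappa> * (norm (d k))\<^sup>2 \<le> E k" and lb: "\<And>k. m \<le> E k"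
  shows "decseq E" "convergent E" "d \<longlonglongrightarrow> 0"
proof -
  show "decseq E"
    using dec \<kappa> by (intro decseq_SucI) (smt (verit) mult_nonneg_nonneg zero_le_power2)
  then obtain v where v: "E \<longlonglongrightarrow> v"
    using decseq_convergent[of E m] lb by blast
  then show "convergent E"
    by (auto simp: convergent_def)
  have lim: "(\<lambda>k. (E k - E (Suc k)) / \<kappa>) \<longlonglongrightarrow> 0"
    using tendsto_divide[OF tendsto_diff[OF v LIMSEQ_Suc[OF v]] tendsto_const[of \<kappa>]] \<kappa> by simp
  have "(\<lambda>k. (norm (d k))\<^sup>2) \<longlonglongrightarrow> 0"
  proof (rule tendsto_sandwich[OF _ _ tendsto_const lim])
    have "(norm (d k))\<^sup>2 \<le> (E k - E (Suc k)) / \<kappa>" for k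
      using dec[of k] \<kappa> by (simp add: field_simps)
    then show "\<forall>\<^sub>F k in sequentially. (norm (d k))\<^sup>2 \<le> (E k - E (Suc k)) / \<kappa>"
      by simp
  qed simp
  then show "d \<longlonglongrightarrow> 0"
    by (simp add: tendsto_norm_zero_iff)
qed

section \<open>Stationarity of limits\<close>

text \<open>The minorant bounds the difference quotient below by - c |y - x|, which tends to
  0.\<close>

lemma quadratic_minorant_imp_frechet_subgradient:
  fixes \<phi> :: "'a::euclidean_space \<Rightarrow> ereal"
  assumes fin: "\<bar>\<phi> x\<bar> \<noteq> \<infinity>"
    and minor: "\<And>y. \<phi> x + ereal (v \<bullet> (y - x) - c * (norm (y - x))\<^sup>2) \<le> \<phi> y"
  shows "v \<in> frechet_subdifferential \<phi> x"
proof -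
  let ?q = "\<lambda>y. (\<phi> y - \<phi> x - ereal (v \<bullet> (y - x))) / ereal (norm (y - x))"
  obtain p where p: "\<phi> x = ereal p"
    using fin by auto
  have "((\<lambda>y. - c * norm (y - x)) \<longlongrightarrow> - c * norm (x - x)) (at x)"
    by (intro tendsto_intros)
  then have "((\<lambda>y. ereal (- c * norm (y - x))) \<longlongrightarrow> ereal 0) (at x)"
    by (intro tendsto_ereal) simp
  then have "Liminf (at x) (\<lambda>y. ereal (- c * norm (y - x))) = ereal 0"
    by (rule lim_imp_Liminf[rotated]) simp
  moreover have "Liminf (at x) (\<lambda>y. ereal (- c * norm (y - x))) \<le> Liminf (at x) ?q"
  proof (rule Liminf_mono)
    have "ereal (- c * norm (y - x)) \<le> ?q y" if "y \<noteq> x" for y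
    proof (cases "\<phi> y")
      case (real r)
      have "- c * (norm (y - x))\<^sup>2 \<le> r - p - v \<bullet> (y - x)"
        using minor[of y] by (simp add: p real)
      then have "- c * norm (y - x) \<le> (r - p - v \<bullet> (y - x)) / norm (y - x)"
        using that by (simp add: pos_le_divide_eq power2_eq_square mult.assoc)
      then show ?thesis
        using that by (simp add: p real)
    next
      case PInf
      then show ?thesis
        using that by (simp add: p)
    next
      case MInf
      then show ?thesis
        using minor[of y] by (simp add: p)
    qed
    then show "\<forall>\<^sub>F y in at x. ereal (- c * norm (y - x)) \<le> ?q y"
      by (simp add: eventually_at_filter)
  qed
  ultimately show ?thesis
    using fin by (simp add: frechet_subdifferential_def zero_ereal_def)
qed

text \<open>Minimality of y gives g a quadratic minorant at y with slope - grad F x - (y - x) /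
  \<gamma>; adding the quadratic lower bound for F at y gives one for the sum, without a sum rule
  for subdifferentials.\<close>

lemma forward_backward_frechet_subgradient:
  fixes F :: "'a::euclidean_space \<Rightarrow> real"
  assumes diff: "\<And>x. F differentiable (at x)" and lip: "L-lipschitz_on UNIV (grad F)"
    and g: "proper g" and \<gamma>: "0 < \<gamma>" and y: "y \<in> prox \<gamma> g (x - \<gamma> *\<^sub>R grad F x)"
  shows "grad F y - grad F x - (1 / \<gamma>) *\<^sub>R (y - x) \<in> frechet_subdifferential (\<lambda>z. ereal (F z) + g z) y"
proof -
  obtain p where p: "g y = ereal p"
    using forward_backward_finite[OF g \<gamma> y] by auto
  define v where "v = grad F y - grad F x - (1 / \<gamma>) *\<^sub>R (y - x)"
  have "v \<in> frechet_subdifferential (\<lambda>z. ereal (F z) + g z) y"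
  proof (rule quadratic_minorant_imp_frechet_subgradient)
    fix z
    let ?b = "v \<bullet> (z - y) - (1 / (2 * \<gamma>) + L / 2) * (norm (z - y))\<^sup>2"
    have "1 / (2 * \<gamma>) * (norm (z - x))\<^sup>2 = 1 / (2 * \<gamma>) * (norm (y - x))\<^sup>2
        + (1 / \<gamma>) * ((y - x) \<bullet> (z - y)) + 1 / (2 * \<gamma>) * (norm (z - y))\<^sup>2"
      by (subst norm_sq_expand[of z x y]) (simp add: distrib_left)
    then have q: "quad_model \<gamma> F x z - quad_model \<gamma> F x y
        = grad F x \<bullet> (z - y) + (1 / \<gamma>) * ((y - x) \<bullet> (z - y)) + 1 / (2 * \<gamma>) * (norm (z - y))\<^sup>2"
      by (simp add: quad_model_def inner_diff_right)
    have key: "F y + p + ?b \<le> F z + s" if "p + quad_model \<gamma> F x y \<le> s + quad_model \<gamma> F x z" for s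
    proof -
      have "v \<bullet> (z - y) = grad F y \<bullet> (z - y) - grad F x \<bullet> (z - y) - (1 / \<gamma>) * ((y - x) \<bullet> (z - y))"
        by (simp add: v_def inner_diff_left)
      moreover have "F y + grad F y \<bullet> (z - y) - L / 2 * (norm (z - y))\<^sup>2 \<le> F z"
        by (rule lipschitz_grad_lower_bound[OF diff lip])
      ultimately show ?thesis
        using that q by (simp only: distrib_right)
    qed
    show "ereal (F y) + g y + ereal ?b \<le> ereal (F z) + g z"
      using forward_backward_minimises[OF \<gamma> y, of z] key p by (cases "g z") auto
  qed (simp add: p)
  then show ?thesis
    by (simp add: v_def)
qed

lemma lower_semicontinuous_sequentially:
  assumes "lower_semicontinuous g" "y \<longlonglongrightarrow> l" "C < g l"
  shows "\<forall>\<^sub>F n in sequentially. C < g (y n)"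
proof -
  have "C < Liminf (at l) g"
    using assms by (auto simp: lower_semicontinuous_def intro: less_le_trans)
  then have "\<forall>\<^sub>F z in at l. C < g z"
    by (rule less_LiminfD)
  \<comment> \<open>The filter \<open>at l\<close> leaves out l; the assumption C < g l restores it,
    as the sequence may hit l.\<close>
  then have "\<forall>\<^sub>F z in nhds l. C < g z"
    using assms(3) by (simp add: eventually_nhds_conv_at)
  then show ?thesis
    by (rule eventually_compose_filterlim[OF _ assms(2)])
qed

text \<open>The limiting subdifferential requires convergence of function values although g need not
  be continuous. Lower semicontinuity gives the lower half, and testing the minimality of y n at l
  the upper half.\<close>

lemma forward_backward_limit:
  fixes F :: "'a::euclidean_space \<Rightarrow> real"
  assumes diff: "\<And>x. F differentiable (at x)" and lip: "L-lipschitz_on UNIV (grad F)"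
    and g: "proper g" "lower_semicontinuous g" and \<gamma>: "0 < \<gamma>"
    and y: "\<And>n. y n \<in> prox \<gamma> g (x n - \<gamma> *\<^sub>R grad F (x n))"
    and x: "x \<longlonglongrightarrow> l" and yx: "(\<lambda>n. y n - x n) \<longlonglongrightarrow> 0"
    and bound: "\<And>n. ereal (F (y n)) + g (y n) \<le> ereal C"
  shows "stationary_point (\<lambda>z. ereal (F z) + g z) l"
    and "(\<lambda>n. g (y n) + ereal (quad_model \<gamma> F (x n) (y n))) \<longlonglongrightarrow> ereal (F l) + g l"
proof -
  have yl: "y \<longlonglongrightarrow> l"
    using tendsto_add[OF yx x] by simp
  have contF: "(\<lambda>n. F (z n)) \<longlonglongrightarrow> F l" if "z \<longlonglongrightarrow> l" for z :: "nat \<Rightarrow> 'a"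
    using differentiable_imp_continuous_within[OF diff[of l]] that
    by (rule isCont_tendsto_compose)
  have contG: "(\<lambda>n. grad F (z n)) \<longlonglongrightarrow> grad F l" if "z \<longlonglongrightarrow> l" for z :: "nat \<Rightarrow> 'a"
    using lipschitz_on_continuous_on[OF lip] that
    by (auto simp: continuous_on_eq_continuous_at intro: isCont_tendsto_compose)
  have "g l \<noteq> \<infinity>"
  proof
    assume "g l = \<infinity>"
    \<comment> \<open>With F (y n) > F l - 1 this would make the sum exceed C.\<close>
    then have "\<forall>\<^sub>F n in sequentially. ereal (C - F l + 1) < g (y n)"
      by (intro lower_semicontinuous_sequentially[OF g(2) yl]) simp
    moreover have "\<forall>\<^sub>F n in sequentially. F l - 1 < F (y n)"
      using contF[OF yl] by (rule order_tendstoD) simp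
    ultimately have "\<forall>\<^sub>F n in sequentially. False"
    proof eventually_elim
      case (elim n)
      then show ?case
        using bound[of n] by (cases "g (y n)") auto
    qed
    then show False by simp
  qed
  then obtain b where b: "g l = ereal b"
    using g(1) by (cases "g l") (auto simp: proper_def)
  have quad_lim: "(\<lambda>n. quad_model \<gamma> F (x n) (z n)) \<longlonglongrightarrow> F l" if "z \<longlonglongrightarrow> l" for z
  proof -
    have "(\<lambda>n. quad_model \<gamma> F (x n) (z n))
        \<longlonglongrightarrow> F l + grad F l \<bullet> (l - l) + 1 / (2 * \<gamma>) * (norm (l - l))\<^sup>2"
      unfolding quad_model_def by (intro tendsto_intros contF contG x that)
    then show ?thesis by simp
  qed
  \<comment> \<open>The excess allowed by comparing y n with l; both models tend to F l, so q tends
    to 0.\<close>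
  define q where "q n = quad_model \<gamma> F (x n) l - quad_model \<gamma> F (x n) (y n)" for n
  have upper: "g (y n) \<le> g l + ereal (q n)" for n
    using forward_backward_minimises[OF \<gamma> y[of n], of l] forward_backward_finite[OF g(1) \<gamma> y[of n]]
    by (cases "g (y n)") (auto simp: b q_def)
  have "(\<lambda>n. b + q n) \<longlonglongrightarrow> b + (F l - F l)"
    unfolding q_def by (intro tendsto_intros quad_lim yl)
  then have q_lim: "(\<lambda>n. g l + ereal (q n)) \<longlonglongrightarrow> g l"
    by (simp add: b)
  have g_lim: "(\<lambda>n. g (y n)) \<longlonglongrightarrow> g l"
  proof (rule order_tendstoI)
    fix a assume "g l < a"
    with q_lim have "\<forall>\<^sub>F n in sequentially. g l + ereal (q n) < a"
      by (rule order_tendstoD)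
    then show "\<forall>\<^sub>F n in sequentially. g (y n) < a"
      by eventually_elim (rule le_less_trans[OF upper])
  qed (rule lower_semicontinuous_sequentially[OF g(2) yl])
  have add_lim: "(\<lambda>n. ereal (u n) + g (y n)) \<longlonglongrightarrow> ereal (F l) + g l" if "u \<longlonglongrightarrow> F l" for u
    using that g_lim by (intro tendsto_add_ereal_general) (auto simp: b)
  show "(\<lambda>n. g (y n) + ereal (quad_model \<gamma> F (x n) (y n))) \<longlonglongrightarrow> ereal (F l) + g l"
    using add_lim[OF quad_lim[OF yl]] by (simp add: add.commute)
  let ?v = "\<lambda>n. grad F (y n) - grad F (x n) - (1 / \<gamma>) *\<^sub>R (y n - x n)"
  have "?v \<longlonglongrightarrow> grad F l - grad F l - (1 / \<gamma>) *\<^sub>R 0"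
    by (intro tendsto_intros contG x yl yx)
  then have v_lim: "?v \<longlonglongrightarrow> 0"
    by simp
  show "stationary_point (\<lambda>z. ereal (F z) + g z) l"
    unfolding stationary_point_def limiting_subdifferential_def mem_Collect_eq
  proof (intro conjI exI allI)
    show "\<bar>ereal (F l) + g l\<bar> \<noteq> \<infinity>"
      by (simp add: b)
    show "?v n \<in> frechet_subdifferential (\<lambda>z. ereal (F z) + g z) (y n)" for n
      by (rule forward_backward_frechet_subgradient[OF diff lip g(1) \<gamma> y])
  qed (fact yl v_lim add_lim[OF contF[OF yl]])+
qed

section \<open>Convergence\<close>

theorem corollary1:
  fixes f h :: "'a::euclidean_space \<Rightarrow> real"
    and g \<phi> :: "'a \<Rightarrow> ereal"
    and Y :: "'a \<Rightarrow> 'a"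
    and L\<^sub>f L\<^sub>h \<rho>\<^sub>f \<gamma>\<^sub>g \<alpha> lam \<gamma> \<gamma>\<^sub>0 :: real
  assumes f_diff: "\<forall>x. f differentiable (at x)"
    and h_diff: "\<forall>x. h differentiable (at x)"
    and f_lip: "L\<^sub>f-lipschitz_on UNIV (grad f)"
    and h_lip: "L\<^sub>h-lipschitz_on UNIV (grad h)"
    and rho: "\<rho>\<^sub>f \<ge> 0"
    and f_wc: "weakly_convex \<rho>\<^sub>f f"
    and g_proper: "proper g"
    and g_lsc: "lower_semicontinuous g"
    and g_prox: "\<gamma>\<^sub>g > 0" "prox_bounded \<gamma>\<^sub>g g"
    and phi: "\<phi> = (\<lambda>x. ereal (f x) + g x + ereal (h x))"
    and phi_min: "minimisers \<phi> \<noteq> {}"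
    and phi_lb: "level_bounded \<phi>"
    and alpha: "0 < \<alpha>" "\<alpha> < 1"
    and lam: "0 < lam" "lam * \<alpha> < 2"
    and gamma: "0 < \<gamma>" "ereal \<gamma> < min (ereal \<gamma>\<^sub>g) (inverse (ereal (L\<^sub>f + L\<^sub>h)))"
    and gamma_hat: "L\<^sub>f > \<rho>\<^sub>f \<longrightarrow> \<gamma>\<^sub>0 \<ge> lam / (2 * (L\<^sub>f - \<rho>\<^sub>f))"
    and gamma_bound: "ereal \<gamma> < stepsize_bound \<gamma>\<^sub>0 L\<^sub>f L\<^sub>h \<rho>\<^sub>f \<alpha> lam"
    and Y_sel: "\<forall>x. Y x \<in> prox \<gamma> g (x - \<gamma> *\<^sub>R grad (\<lambda>z. f z + h z) x)"
  shows "asymptotically_regular (DY \<gamma> \<alpha> lam f Y) \<and>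
    (\<forall>x::nat \<Rightarrow> 'a. (\<forall>k. x (Suc k) = DY \<gamma> \<alpha> lam f Y (x k)) \<longrightarrow>
       bounded (range x) \<and>
       (\<forall>l. cluster_point x l \<longrightarrow> stationary_point \<phi> l) \<and>
       (\<exists>v. stationary_value \<phi> v \<and> (\<lambda>k. DY_envelope \<gamma> f h g (x k)) \<longlonglongrightarrow> ereal v))"
proof -
  define F where "F = (\<lambda>z. f z + h z)"
  define S where "S = DY \<gamma> \<alpha> lam f Y"
  define L where "L = L\<^sub>f + L\<^sub>h"
  define \<eta> where "\<eta> = lam / (2 * \<gamma>)"
  define \<kappa> where "\<kappa> = step_poly_b L\<^sub>f L\<^sub>h \<rho>\<^sub>f \<alpha> lam \<eta> / (2 * lam * \<eta>)"
  \<comment> \<open>The envelope as a real number; g is finite at Y x.\<close>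
  define e where "e x = real_of_ereal (g (Y x)) + quad_model \<gamma> F x (Y x)" for x
  have L0: "0 \<le> L\<^sub>f" "0 \<le> L\<^sub>h"
    using f_lip h_lip by (simp_all add: lipschitz_on_def)
  have F_diff: "F differentiable (at x)" for x
    unfolding F_def using f_diff h_diff by (intro differentiable_add) auto
  have grad_F: "grad F = (\<lambda>x. grad f x + grad h x)"
    unfolding F_def using f_diff h_diff by (intro ext grad_add) auto
  have F_lip: "L-lipschitz_on UNIV (grad F)"
    unfolding grad_F L_def by (rule lipschitz_on_add[OF f_lip h_lip])
  have phi_F: "\<phi> = (\<lambda>x. ereal (F x) + g x)"
  proof
    show "\<phi> x = ereal (F x) + g x" for x
      by (cases "g x") (simp_all add: phi F_def)
  qed
  \<comment> \<open>The case L = 0 is separate because the inverse is then infinite.\<close>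
  have gL: "\<gamma> * L < 1"
    using gamma L0 by (cases "L = 0") (auto simp: L_def field_simps)
  have gLf: "\<gamma> * L\<^sub>f < 1"
    using gL mult_nonneg_nonneg[OF less_imp_le[OF gamma(1)] L0(2)] unfolding L_def distrib_left
    by linarith
  have \<eta>0: "0 < \<eta>"
    using lam gamma by (simp add: \<eta>_def)
  note thresholds = stepsize_above_thresholds[OF gamma(1) gamma_bound lam(1), folded \<eta>_def]
  have \<kappa>0: "0 < \<kappa>"
    using step_poly_b_pos[OF L0 rho alpha lam thresholds(2)] lam \<eta>0 by (simp add: \<kappa>_def)
  have Y: "Y x \<in> prox \<gamma> g (x - \<gamma> *\<^sub>R grad F x)" for x
    using Y_sel by (simp add: F_def)
  have gY: "g (Y x) = ereal (real_of_ereal (g (Y x)))" for x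
    using forward_backward_finite[OF g_proper gamma(1) Y] by (simp add: ereal_real)
  have e: "g (Y x) + ereal (quad_model \<gamma> F x (Y x)) = ereal (e x)" for x
    by (subst gY) (simp add: e_def)
  have envelope: "DY_envelope \<gamma> f h g x = ereal (e x)" for x
    using DY_envelope_eq[of f x h \<gamma> "Y x" g] f_diff h_diff gamma(1) Y e by (simp add: F_def)
  have step: "\<exists>w. w + \<gamma> *\<^sub>R grad f w = x + \<gamma> *\<^sub>R grad f x + lam *\<^sub>R (Y x - x)
      \<and> S x = x + \<alpha> *\<^sub>R (w - x)" for x
  proof -
    obtain w where w: "prox \<gamma> (\<lambda>z. ereal (f z)) ((1 - lam) *\<^sub>R x + \<gamma> *\<^sub>R grad f x + lam *\<^sub>R Y x) = {w}"
      "w + \<gamma> *\<^sub>R grad f w = (1 - lam) *\<^sub>R x + \<gamma> *\<^sub>R grad f x + lam *\<^sub>R Y x"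
      using prox_smooth[OF _ f_lip gamma(1) gLf] f_diff by blast
    have "S x = x + \<alpha> *\<^sub>R (w - x)"
      unfolding S_def DY_def DY_T_def w(1) by (simp add: algebra_simps)
    with w(2) show ?thesis
      by (intro exI[of _ w]) (simp add: algebra_simps)
  qed
  have decrease: "e (S x) + \<kappa> * (norm (S x - x))\<^sup>2 \<le> e x" for x
  proof -
    obtain w where w: "w + \<gamma> *\<^sub>R grad f w = x + \<gamma> *\<^sub>R grad f x + lam *\<^sub>R (Y x - x)"
      "S x = x + \<alpha> *\<^sub>R (w - x)"
      using step by blast
    have "quad_model \<gamma> F (S x) (Y x) + \<kappa> * (norm (S x - x))\<^sup>2 \<le> quad_model \<gamma> F x (Y x)"
      unfolding F_def \<kappa>_def
      by (rule DY_step_decrease[OF _ _ f_lip h_lip f_wc rho alpha lam(1) \<eta>0 _ _ w])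
        (use f_diff h_diff thresholds(1) lam gamma in \<open>auto simp: \<eta>_def\<close>)
    \<comment> \<open>The envelope at the new point is tested at the old Y x, so the values of g
      cancel.\<close>
    moreover have "ereal (e (S x)) \<le> g (Y x) + ereal (quad_model \<gamma> F (S x) (Y x))"
      using forward_backward_minimises[OF gamma(1) Y[of "S x"], of "Y x"] by (simp add: e)
    then have "e (S x) \<le> real_of_ereal (g (Y x)) + quad_model \<gamma> F (S x) (Y x)"
      by (subst (asm) gY) simp
    ultimately show ?thesis
      by (simp add: e_def)
  qed
  have phi_Y: "\<phi> (Y x) \<le> ereal (e x)" for x
  proof -
    have "F (Y x) \<le> F x + grad F x \<bullet> (Y x - x) + L / 2 * (norm (Y x - x))\<^sup>2"
      by (rule lipschitz_grad_upper_bound[OF F_diff F_lip])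
    also have "\<dots> \<le> quad_model \<gamma> F x (Y x)"
      unfolding quad_model_def using gL gamma(1)
      by (intro add_left_mono mult_right_mono) (auto simp: field_simps)
    finally show ?thesis
      unfolding phi_F by (subst gY) (simp add: e_def)
  qed
  \<comment> \<open>The minimum of \<phi> is finite, as \<phi> z \<le> \<phi> (Y z) \<le> e z at a
    minimiser z.\<close>
  obtain m where m: "\<And>x. ereal m \<le> \<phi> x"
  proof -
    obtain z where z: "\<And>y. \<phi> z \<le> \<phi> y"
      using phi_min by (auto simp: minimisers_def)
    have "\<phi> z \<noteq> -\<infinity>"
      using g_proper by (cases "g z") (auto simp: phi_F proper_def)
    with z[of "Y z"] phi_Y[of z] have "\<bar>\<phi> z\<bar> \<noteq> \<infinity>"
      by (cases "\<phi> z") auto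
    with z that show ?thesis
      by (metis ereal_real)
  qed
  have e_lb: "m \<le> e x" for x
    using order_trans[OF m phi_Y[of x]] by simp
  have conv: "decseq (\<lambda>k. e (x k)) \<and> convergent (\<lambda>k. e (x k)) \<and> (\<lambda>k. S (x k) - x k) \<longlonglongrightarrow> 0"
    if "\<forall>k. x (Suc k) = S (x k)" for x :: "nat \<Rightarrow> 'a"
    using sufficient_decrease_convergence[of \<kappa> "\<lambda>k. e (x k)" "\<lambda>k. S (x k) - x k" m]
      \<kappa>0 decrease e_lb that by simp
  have "asymptotically_regular S"
    unfolding asymptotically_regular_def
  proof (intro allI impI)
    fix x :: "nat \<Rightarrow> 'a" assume "\<forall>k. x (Suc k) = S (x k)"
    from conv[OF this] have "(\<lambda>k. - (S (x k) - x k)) \<longlonglongrightarrow> - 0"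
      by (intro tendsto_minus) auto
    then show "(\<lambda>k. x k - S (x k)) \<longlonglongrightarrow> 0"
      by simp
  qed
  moreover have "bounded (range x) \<and> (\<forall>l. cluster_point x l \<longrightarrow> stationary_point \<phi> l) \<and>
      (\<exists>v. stationary_value \<phi> v \<and> (\<lambda>k. DY_envelope \<gamma> f h g (x k)) \<longlonglongrightarrow> ereal v)"
    if xS: "\<forall>k. x (Suc k) = S (x k)" for x :: "nat \<Rightarrow> 'a"
  proof -
    obtain v where v: "(\<lambda>k. e (x k)) \<longlonglongrightarrow> v"
      using conv[OF xS] by (auto simp: convergent_def)
    have "e (x k) \<le> e (x 0)" for k
      using conv[OF xS] by (auto dest: decseqD[of _ 0 k])
    then have phi_le: "\<phi> (Y (x k)) \<le> ereal (e (x 0))" for k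
      using phi_Y[of "x k"] by (meson ereal_less_eq(3) order_trans)
    define K where "K = (1 + \<gamma> * L\<^sub>f) / (lam * \<alpha>)"
    have "norm (Y (x k) - x k) \<le> K * norm (S (x k) - x k)" for k
      using step[of "x k"] DY_residual_bound[OF f_lip alpha(1) lam(1) gamma(1)]
      unfolding K_def by blast
    moreover have "(\<lambda>k. K * norm (S (x k) - x k)) \<longlonglongrightarrow> 0"
      using conv[OF xS] by (intro tendsto_mult_right_zero tendsto_norm_zero) auto
    ultimately have YX: "(\<lambda>k. Y (x k) - x k) \<longlonglongrightarrow> 0"
      by (rule Lim_null_comparison[OF always_eventually[OF allI]])
    have "bounded {z. \<phi> z \<le> ereal (e (x 0))}"
      using phi_lb by (simp add: level_bounded_def)
    then have "bounded (range (\<lambda>k. Y (x k)))"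
      by (rule bounded_subset) (use phi_le in auto)
    \<comment> \<open>x k is Y (x k), which stays in a sublevel set, minus a null sequence.\<close>
    from bounded_minus_comp[OF this convergent_imp_bounded[OF YX]]
    have bdd: "bounded (range x)"
      by simp
    \<comment> \<open>Every cluster point takes the same value v, the limit of the whole envelope
      sequence.\<close>
    have cluster: "stationary_point \<phi> l \<and> \<phi> l = ereal v" if "cluster_point x l" for l
    proof -
      obtain r :: "nat \<Rightarrow> nat" where r: "strict_mono r" "(\<lambda>n. x (r n)) \<longlonglongrightarrow> l"
        using \<open>cluster_point x l\<close> by (auto simp: cluster_point_def o_def)
      have YXr: "(\<lambda>n. Y (x (r n)) - x (r n)) \<longlonglongrightarrow> 0"
        using LIMSEQ_subseq_LIMSEQ[OF YX r(1)] by (simp add: o_def)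
      have "ereal (F (Y (x (r n)))) + g (Y (x (r n))) \<le> ereal (e (x 0))" for n
        using phi_le[of "r n"] by (simp add: phi_F)
      note lim = forward_backward_limit[OF F_diff F_lip g_proper g_lsc gamma(1) Y r(2) YXr this,
          folded phi_F, unfolded e]
      have "(\<lambda>n. ereal (e (x (r n)))) \<longlonglongrightarrow> ereal v"
        using LIMSEQ_subseq_LIMSEQ[OF v r(1)] by (simp add: o_def)
      moreover have "(\<lambda>n. ereal (e (x (r n)))) \<longlonglongrightarrow> \<phi> l"
        using lim(2) by (simp add: phi_F)
      ultimately show ?thesis
        using lim(1) LIMSEQ_unique by blast
    qed
    \<comment> \<open>Boundedness supplies a cluster point, which makes v a stationary
      value.\<close>
    obtain l r where "strict_mono (r :: nat \<Rightarrow> nat)" "(x \<circ> r) \<longlonglongrightarrow> l"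
      using bounded_imp_convergent_subsequence[OF bdd] by blast
    then have "cluster_point x l"
      by (auto simp: cluster_point_def)
    from cluster[OF this] have "stationary_value \<phi> v"
      by (auto simp: stationary_value_def intro!: exI[of _ l])
    with bdd cluster v show ?thesis
      by (auto simp: envelope)
  qed
  ultimately show ?thesis
    by (simp add: S_def)
qed

end
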